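(* Let $s$ be a complex number with $\Re(s)>2$, and choose a real number $c$ such that $c>1$ and $\Re(s)-c>1$. Then $$\Gamma(s)\sum_{m=1}^{\infty}\sum_{n=1}^{\infty}(m+n)^{-s}=\frac{1}{2\pi i}\int_{c-i\infty}^{c+i\infty}\zeta(z)\,\zeta(s-z)\,\Gamma(z)\,\Gamma(s-z)\,dz .$$
   Context: $\Gamma$ is the Gamma function and $\zeta$ is the Riemann zeta function. The integral is taken along the vertical line $\Re(z)=c$, oriented upwards. *)

theory Defs
  imports "HOL-Complex_Analysis.Complex_Analysis"
begin

(* The Dirichlet series, summed over n + 1 = 1, 2, 3, ... *)
definition zeta_series :: "complex \<Rightarrow> complex" where
  "zeta_series z = (\<Sum>n. of_nat (Suc n) powr (-z))"

(* The Riemann zeta function: its Dirichlet series for Re z > 1 and, elsewhere, the value at z of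
   the holomorphic continuation of that series to the plane without 1.  The value at the pole 1
   is a dummy. *)
definition riemann_zeta :: "complex \<Rightarrow> complex" where
  "riemann_zeta z =
     (if Re z > 1 then zeta_series z
      else if z = 1 then 0
      else (THE w. \<exists>f. f holomorphic_on (- {1}) \<and>
                       (\<forall>u. Re u > 1 \<longrightarrow> f u = zeta_series u) \<and> f z = w))"

(* Integration along the line Re z = c, oriented upwards, parametrized by z = c + i t with
   dz = i dt, as a Lebesgue integral over the real line.  The library integral is 0 for
   non-integrable functions, so integrability has to be asserted separately. *)
definition vertical_line_integrable :: "real \<Rightarrow> (complex \<Rightarrow> complex) \<Rightarrow> bool" where
  "vertical_line_integrable c f \<longleftrightarrow> integrable lborel (\<lambda>t::real. f (Complex c t) * \<i>)"

definition vertical_line_integral :: "real \<Rightarrow> (complex \<Rightarrow> complex) \<Rightarrow> complex" where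
  "vertical_line_integral c f = (\<integral>t. f (Complex c t) * \<i> \<partial>lborel)"

end

theory Submission
  imports Defs "HOL-Probability.Probability"
begin

text \<open>With \<open>x = exp u\<close>, Euler's integral exhibits \<open>t \<mapsto> \<Gamma>(c + i t)\<close> as the Fourier transform of
  \<open>u \<mapsto> exp (c u - exp u)\<close>, so Fourier inversion writes \<open>exp (- x)\<close> as the integral of
  \<open>\<Gamma>(z) x powr (- z) / (2 \<pi> i)\<close> over \<open>Re z = c\<close>. Inserting this with \<open>x = m exp u\<close> for one of the two
  factors of \<open>exp (- (m + n) exp u)\<close> in Euler's integral for \<open>\<Gamma>(s) (m + n) powr (- s)\<close> and applying
  Fubini gives the Mellin-Barnes integral of \<open>\<Gamma>(z) \<Gamma>(s - z) m powr (- z) n powr (z - s)\<close>. The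
  Dirichlet series of both zeta factors converge absolutely on the line, so the sums over \<open>n\<close> and
  then \<open>m\<close> may be taken inside the integral.\<close>

section \<open>Fourier inversion on the real line\<close>

text \<open>Since \<open>K\<close> is bounded by 1, the integrand \<open>f x * g y * K x y\<close>
  is dominated by an integrable product, so Fubini applies. It serves twice: for the damped integral
  in the inversion theorem and for the Mellin-Barnes integral.\<close>

lemma
  fixes f g :: "real \<Rightarrow> complex" and K :: "real \<Rightarrow> real \<Rightarrow> complex"
  assumes f: "integrable lborel f" and g: "integrable lborel g"
    and K[measurable]: "(\<lambda>(x, y). K x y) \<in> borel_measurable (borel \<Otimes>\<^sub>M borel)"
    and K1: "\<And>x y. norm (K x y) \<le> 1"
  shows integrable_bounded_kernel: "integrable lborel (\<lambda>x. f x * (\<integral>y. g y * K x y \<partial>lborel))"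
    and bounded_kernel_swap:
      "(\<integral>x. f x * (\<integral>y. g y * K x y \<partial>lborel) \<partial>lborel) =
       (\<integral>y. g y * (\<integral>x. f x * K x y \<partial>lborel) \<partial>lborel)"
proof -
  note [measurable] = borel_measurable_integrable[OF f] borel_measurable_integrable[OF g]
  have "integrable (lborel \<Otimes>\<^sub>M lborel) (\<lambda>(x, y). f x * g y)"
  proof (rule lborel_pair.Fubini_integrable)
    show "(\<lambda>(x, y). f x * g y) \<in> borel_measurable (lborel \<Otimes>\<^sub>M lborel)" by measurable
    show "integrable lborel (\<lambda>x. \<integral>y. norm (case (x, y) of (x, y) \<Rightarrow> f x * g y) \<partial>lborel)"
      using f by (simp add: norm_mult)
    show "AE x in lborel. integrable lborel (\<lambda>y. case (x, y) of (x, y) \<Rightarrow> f x * g y)"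
      using g by simp
  qed
  then have I: "integrable (lborel \<Otimes>\<^sub>M lborel) (\<lambda>(x, y). f x * g y * K x y)"
    by (rule Bochner_Integration.integrable_bound)
       (auto simp: norm_mult intro!: AE_I2 mult_left_le K1)
  show "integrable lborel (\<lambda>x. f x * (\<integral>y. g y * K x y \<partial>lborel))"
    using lborel_pair.integrable_fst'[OF I] by (simp add: mult.assoc)
  have "(\<integral>x. f x * (\<integral>y. g y * K x y \<partial>lborel) \<partial>lborel) =
        (\<integral>x. \<integral>y. f x * g y * K x y \<partial>lborel \<partial>lborel)"
    by (simp add: mult.assoc)
  also have "\<dots> = (\<integral>y. \<integral>x. f x * g y * K x y \<partial>lborel \<partial>lborel)"
    using lborel_pair.Fubini_integral[OF I] ..
  also have "\<dots> = (\<integral>y. g y * (\<integral>x. f x * K x y \<partial>lborel) \<partial>lborel)"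
    by (simp add: mult.assoc mult.left_commute[of "f _" "g _"])
  finally show "(\<integral>x. f x * (\<integral>y. g y * K x y \<partial>lborel) \<partial>lborel) =
        (\<integral>y. g y * (\<integral>x. f x * K x y \<partial>lborel) \<partial>lborel)" .
qed

text \<open>Up to normalization this is the characteristic function of the standard normal
  distribution at x / e, with the integration variable rescaled by e.\<close>

lemma fourier_gaussian:
  fixes e x :: real
  assumes "e > 0"
  shows "(\<integral>t. of_real (exp (- (e * t)\<^sup>2 / 2)) * iexp (t * x) \<partial>lborel) =
         of_real (sqrt (2 * pi) / e * exp (- (x / e)\<^sup>2 / 2))"
proof -
  let ?y = "x / e"
  have "complex_of_real (exp (- ?y\<^sup>2 / 2)) =
      (\<integral>t. std_normal_density t *\<^sub>R iexp (?y * t) \<partial>lborel)"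
    unfolding char_std_normal_distribution[THEN fun_cong, symmetric] char_def
    by (subst integral_density) (auto simp: normal_density_nonneg)
  also have "\<dots> = (\<integral>t. of_real (1 / sqrt (2 * pi)) * (of_real (exp (- t\<^sup>2 / 2)) * iexp (t * ?y)) \<partial>lborel)"
    by (simp add: std_normal_density_def scaleR_conv_of_real mult_ac)
  also have "\<dots> = of_real (1 / sqrt (2 * pi)) * (\<integral>t. of_real (exp (- t\<^sup>2 / 2)) * iexp (t * ?y) \<partial>lborel)"
    by simp
  also have "(\<integral>t. complex_of_real (exp (- t\<^sup>2 / 2)) * iexp (t * ?y) \<partial>lborel) =
      of_real e * (\<integral>t. of_real (exp (- (e * t)\<^sup>2 / 2)) * iexp (t * x) \<partial>lborel)"
    by (subst lborel_integral_real_affine[where c = e and t = 0])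
       (use assms in \<open>auto simp: scaleR_conv_of_real\<close>)
  finally show ?thesis
    using assms by (simp add: field_simps)
qed

lemma integrable_gaussian:
  fixes e :: real
  assumes "e > 0"
  shows "integrable lborel (\<lambda>t. exp (- (e * t)\<^sup>2 / 2))"
proof -
  have "integrable lborel (\<lambda>t. sqrt (2 * pi) * std_normal_density t)"
    using integrable_normal_density[of 1 0] by simp
  then have "integrable lborel (\<lambda>t. exp (- t\<^sup>2 / 2) :: real)"
    by (simp add: std_normal_density_def)
  from lborel_integrable_real_affine[OF this, of e 0] assms show ?thesis
    by simp
qed

text \<open>Damping by the Gaussian \<open>exp (- (e t)\<^sup>2 / 2)\<close> makes Fubini applicable and turns the left-hand
  side into an average of \<open>h\<close> around \<open>v\<close>; then let \<open>e\<close> tend to zero.\<close>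

theorem fourier_inversion:
  fixes h :: "real \<Rightarrow> complex" and v :: real
  defines "H \<equiv> \<lambda>t. \<integral>u. h u * iexp (t * u) \<partial>lborel"
  assumes cont: "continuous_on UNIV h" and bound: "\<And>u. norm (h u) \<le> B"
    and int: "integrable lborel h" and intH: "integrable lborel H"
  shows "(\<integral>t. H t * iexp (- (t * v)) \<partial>lborel) = 2 * of_real pi * h v"
proof (rule LIMSEQ_unique)
  define e :: "nat \<Rightarrow> real" where "e n = 1 / real (Suc n)" for n
  have e: "e n > 0" for n by (simp add: e_def)
  have elim: "e \<longlonglongrightarrow> 0"
    unfolding e_def using LIMSEQ_inverse_real_of_nat by (simp add: field_simps)
  define G where "G n t = exp (- (e n * t)\<^sup>2 / 2)" for n t
  have [measurable]: "h \<in> borel_measurable borel" "H \<in> borel_measurable borel"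
    using int intH by (auto dest: borel_measurable_integrable)
  have [measurable]: "G n \<in> borel_measurable borel" for n
    unfolding G_def by measurable
  \<comment> \<open>\<open>?L n\<close> is the damped integral. Its limit is computed in two ways,
    and uniqueness of limits gives the identity.\<close>
  let ?L = "\<lambda>n. \<integral>t. H t * iexp (- (t * v)) * of_real (G n t) \<partial>lborel"
  show "?L \<longlonglongrightarrow> (\<integral>t. H t * iexp (- (t * v)) \<partial>lborel)"
  proof (rule integral_dominated_convergence[where w = "\<lambda>t. norm (H t)"])
    show "AE t in lborel. (\<lambda>n. H t * iexp (- (t * v)) * of_real (G n t)) \<longlonglongrightarrow> H t * iexp (- (t * v))"
    proof (intro AE_I2)
      fix t :: real
      have "(\<lambda>n. H t * iexp (- (t * v)) * of_real (G n t)) \<longlonglongrightarrow>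
          H t * iexp (- (t * v)) * of_real (exp (- (0 * t)\<^sup>2 / 2))"
        unfolding G_def by (intro tendsto_intros elim) auto
      then show "(\<lambda>n. H t * iexp (- (t * v)) * of_real (G n t)) \<longlonglongrightarrow> H t * iexp (- (t * v))"
        by simp
    qed
    show "AE t in lborel. norm (H t * iexp (- (t * v)) * of_real (G n t)) \<le> norm (H t)" for n
      by (auto simp: norm_mult G_def intro!: AE_I2 mult_left_le)
  qed (use intH in auto)
  have L: "?L n = (\<integral>w. of_real (2 * pi * std_normal_density w) * h (v + e n * w) \<partial>lborel)" for n
  proof -
    let ?g = "\<lambda>t. of_real (G n t) * iexp (- (t * v))"
    have intg: "integrable lborel ?g"
      by (rule Bochner_Integration.integrable_bound[OF integrable_gaussian[OF e[of n]]])
         (auto simp: norm_mult G_def)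
    have "?L n = (\<integral>t. ?g t * (\<integral>u. h u * iexp (t * u) \<partial>lborel) \<partial>lborel)"
      by (simp add: H_def mult_ac)
    also have "\<dots> = (\<integral>u. h u * (\<integral>t. ?g t * iexp (t * u) \<partial>lborel) \<partial>lborel)"
      by (rule bounded_kernel_swap[OF intg int]) auto
    also have "\<dots> = (\<integral>u. h u * (\<integral>t. of_real (G n t) * iexp (t * (u - v)) \<partial>lborel) \<partial>lborel)"
      by (simp add: mult.assoc right_diff_distrib exp_add exp_diff exp_minus field_simps)
    also have "\<dots> = (\<integral>u. h u * of_real (sqrt (2 * pi) / e n * exp (- ((u - v) / e n)\<^sup>2 / 2)) \<partial>lborel)"
      unfolding G_def fourier_gaussian[OF e] ..
    \<comment> \<open>The substitution u = v + \<open>e n\<close> * w centres the Gaussian at v; its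
      Jacobian \<open>e n\<close> will cancel the factor 1 / \<open>e n\<close>.\<close>
    also have "\<dots> = of_real (e n) * (\<integral>w. h (v + e n * w) *
        of_real (sqrt (2 * pi) / e n * exp (- w\<^sup>2 / 2)) \<partial>lborel)"
      by (subst lborel_integral_real_affine[where c = "e n" and t = v])
         (use e[of n] in \<open>auto simp: scaleR_conv_of_real\<close>)
    also have "\<dots> = (\<integral>w. of_real (e n) * (h (v + e n * w) *
        of_real (sqrt (2 * pi) / e n * exp (- w\<^sup>2 / 2))) \<partial>lborel)"
      by simp
    also have "\<dots> = (\<integral>w. of_real (2 * pi * std_normal_density w) * h (v + e n * w) \<partial>lborel)"
    proof (rule Bochner_Integration.integral_cong[OF refl])
      fix w :: real
      \<comment> \<open>As sqrt(2 pi) = 2 pi / sqrt(2 pi), the kernel is 2 pi times a probability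
        density. This is the origin of the factor 2 pi in the inversion formula.\<close>
      have eq: "e n * (sqrt (2 * pi) / e n * exp (- w\<^sup>2 / 2)) = 2 * pi * std_normal_density w"
        using e[of n] by (simp add: std_normal_density_def field_simps flip: real_sqrt_mult)
      have "of_real (e n) * (h (v + e n * w) * of_real (sqrt (2 * pi) / e n * exp (- w\<^sup>2 / 2))) =
          of_real (e n * (sqrt (2 * pi) / e n * exp (- w\<^sup>2 / 2))) * h (v + e n * w)"
        by (simp only: of_real_mult mult_ac)
      then show "of_real (e n) * (h (v + e n * w) * of_real (sqrt (2 * pi) / e n * exp (- w\<^sup>2 / 2))) =
          of_real (2 * pi * std_normal_density w) * h (v + e n * w)"
        unfolding eq .
    qed
    finally show ?thesis .
  qed
  \<comment> \<open>Continuity of \<open>h\<close> at v gives the pointwise limit, and its bound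
    \<open>B\<close> an integrable majorant.\<close>
  have "(\<lambda>n. \<integral>w. of_real (2 * pi * std_normal_density w) * h (v + e n * w) \<partial>lborel)
      \<longlonglongrightarrow> (\<integral>w. of_real (2 * pi * std_normal_density w) * h v \<partial>lborel)"
  proof (rule integral_dominated_convergence[where w = "\<lambda>w. 2 * pi * std_normal_density w * B"])
    show "AE w in lborel. (\<lambda>n. of_real (2 * pi * std_normal_density w) * h (v + e n * w))
        \<longlonglongrightarrow> of_real (2 * pi * std_normal_density w) * h v"
    proof (intro AE_I2 tendsto_intros)
      fix w :: real
      have "(\<lambda>n. v + e n * w) \<longlonglongrightarrow> v + 0 * w" by (intro tendsto_intros elim)
      then show "(\<lambda>n. h (v + e n * w)) \<longlonglongrightarrow> h v"
        using cont by (auto intro: continuous_on_tendsto_compose)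
    qed
    show "AE w in lborel. norm (of_real (2 * pi * std_normal_density w) * h (v + e n * w))
        \<le> 2 * pi * std_normal_density w * B" for n
      using bound by (auto simp: norm_mult normal_density_nonneg intro!: AE_I2 mult_left_mono)
  qed (auto intro!: integrable_normal_density)
  moreover have "(\<integral>w. of_real (2 * pi * std_normal_density w) * h v \<partial>lborel) = 2 * of_real pi * h v"
    using integral_normal_density[of 1 0] by (simp add: integral_complex_of_real)
  ultimately show "?L \<longlonglongrightarrow> 2 * of_real pi * h v"
    unfolding L by simp
qed

section \<open>The Mellin transform of the exponential\<close>

text \<open>Euler's integral under the substitution x = exp u: the Jacobian exp u raises the
  exponent s - 1 to s.\<close>

lemma
  fixes s :: complex
  assumes s: "Re s > 0"
  shows integrable_Gamma_exp: "integrable lborel (\<lambda>u. exp (of_real u * s - of_real (exp u)))"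
    and integral_Gamma_exp: "(\<integral>u. exp (of_real u * s - of_real (exp u)) \<partial>lborel) = Gamma s"
proof -
  let ?f = "\<lambda>t. complex_of_real t powr (s - 1) / of_real (exp t)"
  let ?g = "\<lambda>u. exp (of_real u * s - of_real (exp u))"
  have eq: "\<bar>exp u\<bar> *\<^sub>R ?f (exp u) = ?g u" for u :: real
    by (simp add: powr_def Ln_of_real scaleR_conv_of_real exp_diff exp_of_real ring_distribs mult.commute
        flip: exp_of_real)
  have range: "range (exp :: real \<Rightarrow> real) = {0<..}"
    by (auto simp: image_iff intro: exp_ln[symmetric])
  have "?f absolutely_integrable_on {0<..}" "integral {0<..} ?f = Gamma s"
    using absolutely_integrable_Gamma_integral'[OF s] Gamma_integral_complex'[OF s]
    by (auto dest: integral_unique)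
  then have "?f absolutely_integrable_on range exp \<and> integral (range exp) ?f = Gamma s"
    by (simp only: range)
  then have "(\<lambda>u. \<bar>exp u\<bar> *\<^sub>R ?f (exp u)) absolutely_integrable_on UNIV \<and>
      integral UNIV (\<lambda>u. \<bar>exp u\<bar> *\<^sub>R ?f (exp u)) = Gamma s"
    by (subst has_absolute_integral_change_of_variables_real)
       (auto intro!: derivative_eq_intros simp: inj_on_def)
  then have g: "?g absolutely_integrable_on UNIV" "integral UNIV ?g = Gamma s"
    unfolding eq by auto
  \<comment> \<open>The change of variables speaks about Lebesgue measure, the completion of
    \<open>lborel\<close>; Borel measurability of the integrand carries both results over.\<close>
  have [measurable]: "?g \<in> borel_measurable borel" by measurable
  show int: "integrable lborel ?g"
    using g(1) by (simp add: set_integrable_def integrable_completion)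
  show "integral\<^sup>L lborel ?g = Gamma s"
    using set_lebesgue_integral_eq_integral(2)[OF g(1)] g(2) integral_completion[of ?g lborel]
    by (simp add: set_lebesgue_integral_def)
qed

text \<open>The integrand in \<open>integral_Gamma_exp\<close> has modulus exp(u Re z - exp u),
  which is the integrand for the real argument Re z.\<close>

lemma norm_Gamma_le:
  assumes "Re z > 0"
  shows "norm (Gamma z) \<le> Gamma (Re z)"
proof -
  have "norm (Gamma z) \<le> (\<integral>u. norm (exp (of_real u * z - of_real (exp u))) \<partial>lborel)"
    unfolding integral_Gamma_exp[OF assms, symmetric] by (rule integral_norm_bound)
  also have "complex_of_real \<dots> =
      (\<integral>u. exp (of_real u * of_real (Re z) - of_real (exp u)) \<partial>lborel)"
    by (simp add: norm_exp_eq_Re exp_of_real[symmetric] flip: integral_complex_of_real)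
  then have "(\<integral>u. norm (exp (of_real u * z - of_real (exp u))) \<partial>lborel) = Gamma (Re z)"
    using integral_Gamma_exp[of "of_real (Re z)"] assms
    by (simp add: Gamma_complex_of_real)
  finally show ?thesis .
qed

text \<open>Translating u by \<open>ln a\<close> absorbs the scale a into the inner exponential and
  leaves the constant factor a powr (-s).\<close>

lemma
  fixes s :: complex and a :: real
  assumes s: "Re s > 0" and a: "a > 0"
  shows integrable_Gamma_exp_scaled:
      "integrable lborel (\<lambda>u. exp (of_real u * s - of_real (a * exp u)))"
    and integral_Gamma_exp_scaled:
      "(\<integral>u. exp (of_real u * s - of_real (a * exp u)) \<partial>lborel) = Gamma s * of_real a powr (-s)"
proof -
  let ?g = "\<lambda>u. exp (of_real u * s - of_real (exp u))"
  have eq: "exp (of_real u * s - of_real (a * exp u)) = of_real a powr (-s) * ?g (ln a + 1 * u)" for u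
    using a by (simp add: powr_def Ln_of_real exp_add ring_distribs flip: exp_of_real)
       (simp add: exp_of_real exp_diff exp_add exp_minus mult.commute)
  show "integrable lborel (\<lambda>u. exp (of_real u * s - of_real (a * exp u)))"
    unfolding eq using lborel_integrable_real_affine[OF integrable_Gamma_exp[OF s], of 1 "ln a"]
    by simp
  show "(\<integral>u. exp (of_real u * s - of_real (a * exp u)) \<partial>lborel) = Gamma s * of_real a powr (-s)"
    unfolding eq using lborel_integral_real_affine[of 1 ?g "ln a"]
    by (simp add: integral_Gamma_exp[OF s])
qed

text \<open>The bound \<open>\<bar>\<Gamma>(z + 2)\<bar> \<le> \<Gamma>(Re z + 2)\<close> gains two powers of \<open>t\<close> through
  \<open>\<Gamma>(z) = \<Gamma>(z + 2) / (z (z + 1))\<close>, so no Stirling estimate is needed.\<close>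

lemma integrable_Gamma_vertical:
  fixes c :: real
  assumes c: "c > 0"
  shows "integrable lborel (\<lambda>t. Gamma (Complex c t))"
proof -
  \<comment> \<open>The constant reflects (1 + 1/c^2) (c^2 + t^2) \<ge> 1 + t^2, which compares the
    bound Gamma(c + 2) / (c^2 + t^2) with a multiple of 1 / (1 + t^2).\<close>
  define C where "C = Gamma (c + 2) * (1 + 1 / c\<^sup>2)"
  have int: "integrable lborel (\<lambda>t::real. C * inverse (1 + t\<^sup>2))"
    using integrable_inverse_1_plus_square by (simp add: set_integrable_def)
  show ?thesis
  proof (rule Bochner_Integration.integrable_bound[OF int])
    have "isCont (\<lambda>t. Gamma (Complex c t)) t" for t
      using c unfolding Complex_eq
      by (intro continuous_intros) (auto simp: complex_eq_iff elim!: nonpos_Ints_cases)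
    then have "continuous_on UNIV (\<lambda>t. Gamma (Complex c t))"
      by (simp add: continuous_at_imp_continuous_on)
    then show "(\<lambda>t. Gamma (Complex c t)) \<in> borel_measurable lborel"
      by (simp add: borel_measurable_continuous_onI)
    show "AE t in lborel. norm (Gamma (Complex c t)) \<le> norm (C * inverse (1 + t\<^sup>2))"
    proof (intro AE_I2)
      fix t :: real
      let ?z = "Complex c t"
      have "?z \<notin> \<int>\<^sub>\<le>\<^sub>0" "?z + 1 \<notin> \<int>\<^sub>\<le>\<^sub>0"
        using c by (auto simp: complex_eq_iff elim!: nonpos_Ints_cases)
      then have "(?z + 1) * (?z * Gamma ?z) = Gamma (?z + 1 + 1)"
        by (metis Gamma_plus1)
      also have "?z + 1 + 1 = ?z + 2"
        by simp
      finally have eq: "norm (Gamma (?z + 2)) = norm (?z + 1) * norm ?z * norm (Gamma ?z)"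
        by (metis norm_mult mult.assoc)
      \<comment> \<open>Because Re z = c > 0, adding 1 increases the modulus, so the two recursion
        factors contribute at least |z|^2 = c^2 + t^2.\<close>
      have "norm ?z * norm ?z \<le> norm (?z + 1) * norm ?z"
        using c by (intro mult_right_mono) (auto simp: cmod_def intro!: power_mono)
      moreover have "norm ?z * norm ?z = c\<^sup>2 + t\<^sup>2"
        by (simp add: cmod_def flip: power2_eq_square)
      ultimately have "(c\<^sup>2 + t\<^sup>2) * norm (Gamma ?z) \<le> norm (Gamma (?z + 2))"
        unfolding eq by (simp add: mult_right_mono)
      also have "\<dots> \<le> Gamma (c + 2)"
        using norm_Gamma_le[of "?z + 2"] c by simp
      finally have *: "norm (Gamma ?z) \<le> Gamma (c + 2) / (c\<^sup>2 + t\<^sup>2)"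
        using c by (simp add: field_simps add_pos_nonneg)
      also have "1 / (c\<^sup>2 + t\<^sup>2) \<le> (1 + 1 / c\<^sup>2) / (1 + t\<^sup>2)"
        using c by (simp add: divide_simps add_pos_nonneg) (simp add: algebra_simps)
      then have "Gamma (c + 2) / (c\<^sup>2 + t\<^sup>2) \<le> C * inverse (1 + t\<^sup>2)"
        using mult_left_mono[of "1 / (c\<^sup>2 + t\<^sup>2)" _ "Gamma (c + 2)"] c
        by (simp add: C_def Gamma_real_pos less_imp_le divide_inverse mult.assoc)
      finally show "norm (Gamma ?z) \<le> norm (C * inverse (1 + t\<^sup>2))"
        by simp
    qed
  qed
qed

text \<open>Fourier inversion for u \<mapsto> exp(c u - exp u) at the point ln x. The factor x powr
  (-c) split off from x powr (-z) cancels exp(c ln x).\<close>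

theorem inverse_Mellin_Gamma:
  fixes c x :: real
  assumes c: "c > 0" and x: "x > 0"
  shows "(\<integral>t. Gamma (Complex c t) * of_real x powr (- Complex c t) \<partial>lborel) =
         2 * of_real pi * of_real (exp (-x))"
proof -
  define h where "h u = complex_of_real (exp (u * c - exp u))" for u
  have h: "h u = exp (of_real u * of_real c - of_real (exp u))" for u
    by (simp add: h_def flip: exp_of_real)
  have H: "(\<integral>u. h u * iexp (t * u) \<partial>lborel) = Gamma (Complex c t)" for t
  proof -
    have "h u * iexp (t * u) = exp (of_real u * Complex c t - of_real (exp u))" for u
      by (simp add: h Complex_eq algebra_simps flip: exp_add)
    then show ?thesis
      using c by (simp add: integral_Gamma_exp)
  qed
  have bound: "norm (h u) \<le> exp (c * ln c - c)" for u
  proof -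
    \<comment> \<open>The exponent u c - exp u is largest at u = ln c; the inequality 1 + y \<le>
      exp y at y = u - ln c yields this maximum.\<close>
    have "c * (1 + (u - ln c)) \<le> c * exp (u - ln c)"
      using c by (intro mult_left_mono exp_ge_add_one_self) simp
    then have "u * c - exp u \<le> c * ln c - c"
      using c by (simp add: exp_diff algebra_simps)
    then show ?thesis
      unfolding h_def by (simp only: norm_of_real abs_exp_cancel exp_le_cancel_iff)
  qed
  have "(\<integral>t. Gamma (Complex c t) * iexp (- (t * ln x)) \<partial>lborel) = 2 * of_real pi * h (ln x)"
  proof -
    have "continuous_on UNIV h"
      unfolding h by (intro continuous_intros)
    moreover have "integrable lborel h"
      unfolding h using integrable_Gamma_exp[of "of_real c"] c by simp
    ultimately show ?thesis
      using fourier_inversion[of h, OF _ bound, unfolded H] integrable_Gamma_vertical[OF c] by blast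
  qed
  then have *: "of_real (x powr (-c)) * (\<integral>t. Gamma (Complex c t) * iexp (- (t * ln x)) \<partial>lborel) =
      2 * of_real pi * (of_real (x powr (-c)) * h (ln x))"
    by (simp only: mult.left_commute)
  have "of_real x powr (- Complex c t) = of_real (x powr (-c)) * iexp (- (t * ln x))" for t
    using x by (simp add: powr_def Ln_of_real Complex_eq ring_distribs mult_ac exp_add exp_minus exp_diff
        flip: exp_of_real)
       (simp add: field_simps exp_minus flip: exp_add)
  then have "(\<integral>t. Gamma (Complex c t) * of_real x powr (- Complex c t) \<partial>lborel) =
      of_real (x powr (-c)) * (\<integral>t. Gamma (Complex c t) * iexp (- (t * ln x)) \<partial>lborel)"
    by (simp add: mult.left_commute[of "Gamma _"])
  moreover have "of_real (x powr (-c)) * h (ln x) = of_real (exp (-x))"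
    using x by (simp add: h_def powr_def exp_diff exp_minus field_simps)
  ultimately show ?thesis
    using * by simp
qed

section \<open>The Mellin-Barnes integral\<close>

lemma norm_of_real_powr:
  assumes "a > 0"
  shows "norm (complex_of_real a powr z) = a powr Re z"
  using assms by (simp add: norm_powr_real_powr)

lemma borel_measurable_powr_complex_exponent [measurable (raw)]:
  fixes a :: complex and w :: "'a \<Rightarrow> complex"
  assumes "w \<in> borel_measurable M"
  shows "(\<lambda>t. a powr w t) \<in> borel_measurable M"
  using assms unfolding powr_def by measurable

lemma borel_measurable_vertical [measurable]: "Complex c \<in> borel_measurable borel"
  unfolding Complex_eq[abs_def] by measurable

text \<open>A Parseval argument: the second Gamma factor with its power of b is a Fourier transform
  in t, and moving that transform onto the first factor leaves an inverse Mellin integral.\<close>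

lemma
  fixes s :: complex and a b c :: real
  assumes c: "c > 0" "Re s > c" and a: "a > 0" and b: "b > 0"
  defines "F \<equiv> \<lambda>t. (Gamma (Complex c t) * of_real a powr (- Complex c t)) *
      (Gamma (s - Complex c t) * of_real b powr (- (s - Complex c t)))"
  shows integrable_Mellin_Barnes: "integrable lborel F"
    and integral_Mellin_Barnes:
      "(\<integral>t. F t \<partial>lborel) = 2 * of_real pi * Gamma s * of_real (a + b) powr (-s)"
proof -
  let ?f = "\<lambda>t. Gamma (Complex c t) * of_real a powr (- Complex c t)"
  let ?g = "\<lambda>u. exp (of_real u * (s - of_real c) - of_real (b * exp u))"
  have Gamma_meas [measurable]: "(\<lambda>t. Gamma (Complex c t)) \<in> borel_measurable borel"
    using integrable_Gamma_vertical[OF c(1)] by (auto dest: borel_measurable_integrable)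
  have f: "integrable lborel ?f"
  proof (rule Bochner_Integration.integrable_bound)
    show "integrable lborel (\<lambda>t. of_real (a powr (-c)) * Gamma (Complex c t))"
      using integrable_Gamma_vertical[OF c(1)] by simp
    show "?f \<in> borel_measurable lborel"
      by measurable
    show "AE t in lborel. norm (?f t) \<le> norm (of_real (a powr (-c)) * Gamma (Complex c t))"
      using a by (intro AE_I2) (simp add: norm_mult norm_of_real_powr)
  qed
  have g: "integrable lborel ?g"
    using integrable_Gamma_exp_scaled[of "s - of_real c" b] c b by simp
  have inner_g: "(\<integral>u. ?g u * iexp (- (t * u)) \<partial>lborel) =
      Gamma (s - Complex c t) * of_real b powr (- (s - Complex c t))" for t
  proof -
    have "?g u * iexp (- (t * u)) = exp (of_real u * (s - Complex c t) - of_real (b * exp u))" for u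
      by (simp add: Complex_eq algebra_simps flip: exp_add)
    then show ?thesis
      using integral_Gamma_exp_scaled[of "s - Complex c t" b] c b by simp
  qed
  have inner_f: "(\<integral>t. ?f t * iexp (- (t * u)) \<partial>lborel) =
      2 * of_real pi * exp (of_real u * of_real c - of_real (a * exp u))" for u
  proof -
    \<comment> \<open>With z = c + i t the kernel is exp(u c) exp(-u z), and exp(-u z) merges with a
      powr (-z) into (a exp u) powr (-z). Mellin inversion then applies at x = a exp u.\<close>
    have "?f t * iexp (- (t * u)) = exp (of_real u * of_real c) *
        (Gamma (Complex c t) * of_real (a * exp u) powr (- Complex c t))" for t
    proof -
      have "of_real (a * exp u) powr (- Complex c t) = exp (- Complex c t * of_real (ln a + u))"
        using a by (simp add: powr_def Ln_of_real ln_mult del: of_real_mult of_real_add)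
      also have "\<dots> = of_real a powr (- Complex c t) * exp (- (of_real u * Complex c t))"
        using a by (simp add: powr_def Ln_of_real algebra_simps flip: exp_add)
      finally have "of_real (a * exp u) powr (- Complex c t) =
          of_real a powr (- Complex c t) * exp (- (of_real u * Complex c t))" .
      moreover have "exp (- (of_real u * Complex c t)) = iexp (- (t * u)) * exp (- (of_real u * of_real c))"
        by (simp add: Complex_eq algebra_simps flip: exp_add)
      ultimately show ?thesis
        by (simp add: exp_minus field_simps)
    qed
    then have "(\<integral>t. ?f t * iexp (- (t * u)) \<partial>lborel) = exp (of_real u * of_real c) *
        (\<integral>t. Gamma (Complex c t) * of_real (a * exp u) powr (- Complex c t) \<partial>lborel)"
      by (simp only: integral_mult_right_zero)
    also have "\<dots> = 2 * of_real pi * (exp (of_real u * of_real c) * of_real (exp (- (a * exp u))))"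
      using a by (subst inverse_Mellin_Gamma[OF c(1)]) auto
    finally show ?thesis
      by (simp add: exp_diff exp_minus divide_inverse flip: exp_of_real)
  qed
  have F: "F = (\<lambda>t. ?f t * (\<integral>u. ?g u * iexp (- (t * u)) \<partial>lborel))"
    unfolding inner_g F_def ..
  show "integrable lborel F"
    unfolding F by (rule integrable_bounded_kernel[OF f g]) auto
  have "(\<integral>t. F t \<partial>lborel) = (\<integral>u. ?g u * (\<integral>t. ?f t * iexp (- (t * u)) \<partial>lborel) \<partial>lborel)"
    unfolding F by (rule bounded_kernel_swap[OF f g]) auto
  also have "\<dots> = (\<integral>u. 2 * of_real pi * exp (of_real u * s - of_real ((a + b) * exp u)) \<partial>lborel)"
  proof (rule Bochner_Integration.integral_cong[OF refl])
    fix u :: real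
    \<comment> \<open>The terms in c cancel, and the two decaying exponentials combine into exp(-(a
      + b) exp u), which produces the sum a + b.\<close>
    have "?g u * exp (of_real u * of_real c - of_real (a * exp u)) =
        exp (of_real u * s - of_real ((a + b) * exp u))"
      by (simp add: algebra_simps flip: exp_add)
    then show "?g u * (\<integral>t. ?f t * iexp (- (t * u)) \<partial>lborel) =
        2 * of_real pi * exp (of_real u * s - of_real ((a + b) * exp u))"
      unfolding inner_f by (simp only: mult.left_commute[of "?g u"])
  qed
  also have "\<dots> = 2 * of_real pi * (\<integral>u. exp (of_real u * s - of_real ((a + b) * exp u)) \<partial>lborel)"
    by (rule integral_mult_right_zero)
  also have "\<dots> = 2 * of_real pi * Gamma s * of_real (a + b) powr (-s)"
    using a b c by (subst integral_Gamma_exp_scaled) auto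
  finally show "(\<integral>t. F t \<partial>lborel) = 2 * of_real pi * Gamma s * of_real (a + b) powr (-s)" .
qed

section \<open>Summation\<close>

text \<open>The n-th term has norm |P t| (n + 1) powr (-\<sigma>), so the L1 norms form a convergent
  series and sum and integral may be interchanged. The weight \<open>P\<close> is left general
  because the zeta factors are inserted one after the other.\<close>

lemma
  fixes P :: "real \<Rightarrow> complex" and w :: "real \<Rightarrow> complex"
  assumes P: "integrable lborel P" and w[measurable]: "w \<in> borel_measurable borel"
    and Re_w: "\<And>t. Re (w t) = \<sigma>" and \<sigma>: "\<sigma> > 1"
  shows integrable_times_zeta_series: "integrable lborel (\<lambda>t. P t * zeta_series (w t))"
    and sums_integral_times_zeta_series:
      "(\<lambda>n. \<integral>t. P t * of_nat (Suc n) powr (- w t) \<partial>lborel) sums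
         (\<integral>t. P t * zeta_series (w t) \<partial>lborel)"
proof -
  let ?f = "\<lambda>n t. P t * of_nat (Suc n) powr (- w t)"
  have norm_pow: "norm (complex_of_nat (Suc n) powr (- w t)) = real (Suc n) powr (-\<sigma>)" for n t
    using norm_of_real_powr[of "real (Suc n)" "- w t"] by (simp add: Re_w)
  have norm_f: "norm (?f n t) = norm (P t) * real (Suc n) powr (-\<sigma>)" for n t
    by (simp only: norm_mult norm_pow)
  have sum_pow: "summable (\<lambda>n. real (Suc n) powr (-\<sigma>))"
    using \<sigma> by (subst summable_Suc_iff) (simp add: summable_real_powr_iff)
  have [measurable]: "P \<in> borel_measurable borel"
    using P by (auto dest: borel_measurable_integrable)
  have int: "integrable lborel (?f n)" for n
  proof (rule Bochner_Integration.integrable_bound)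
    show "integrable lborel (\<lambda>t. norm (P t) * real (Suc n) powr (-\<sigma>))"
      using P by simp
    show "AE t in lborel. norm (?f n t) \<le> norm (norm (P t) * real (Suc n) powr (-\<sigma>))"
      unfolding norm_f by (intro AE_I2) simp
  qed measurable
  have summable: "AE t in lborel. summable (\<lambda>n. norm (?f n t))"
    unfolding norm_f by (intro AE_I2 summable_mult sum_pow)
  have sums: "summable (\<lambda>n. \<integral>t. norm (?f n t) \<partial>lborel)"
    unfolding norm_f using sum_pow by (simp add: summable_mult)
  have "summable (\<lambda>n. complex_of_nat (Suc n) powr (- w t))" for t
    by (rule summable_norm_cancel) (use sum_pow in \<open>simp only: norm_pow\<close>)
  then have suminf: "(\<Sum>n. ?f n t) = P t * zeta_series (w t)" for t
    unfolding zeta_series_def by (rule suminf_mult)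
  show "integrable lborel (\<lambda>t. P t * zeta_series (w t))"
    using integrable_suminf[OF int summable sums] unfolding suminf .
  show "(\<lambda>n. \<integral>t. ?f n t \<partial>lborel) sums (\<integral>t. P t * zeta_series (w t) \<partial>lborel)"
    using sums_integral[OF int summable sums] unfolding suminf .
qed

theorem lemma2p14:
  fixes s :: complex and c :: real
  assumes "Re s > 2" and "c > 1" and "Re s - c > 1"
  shows "(\<forall>m::nat. summable (\<lambda>n::nat. of_nat (Suc m + Suc n) powr (-s))) \<and>
         summable (\<lambda>m::nat. \<Sum>n::nat. of_nat (Suc m + Suc n) powr (-s)) \<and>
         vertical_line_integrable c
           (\<lambda>z. riemann_zeta z * riemann_zeta (s - z) * Gamma z * Gamma (s - z)) \<and>
         Gamma s * (\<Sum>m::nat. \<Sum>n::nat. of_nat (Suc m + Suc n) powr (-s)) =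
           1 / (2 * of_real pi * \<i>) *
           vertical_line_integral c
             (\<lambda>z. riemann_zeta z * riemann_zeta (s - z) * Gamma z * Gamma (s - z))"
proof -
  let ?z = "Complex c"
  define G where "G t = Gamma (?z t) * Gamma (s - ?z t)" for t
  define k where "k = 2 * of_real pi * Gamma s"
  have c: "c > 0" "Re s > c" "c > 1" "Re s - c > 1"
    using assms by auto
  \<comment> \<open>In the library \<open>Gamma\<close> takes the value 0 exactly at its poles,
    which Re s > 2 excludes. The series will be divided by \<open>k\<close>.\<close>
  have k: "k \<noteq> 0"
    using assms(1) by (auto simp: k_def Gamma_eq_zero_iff elim!: nonpos_Ints_cases)
  \<comment> \<open>Taking b = 1 in the Mellin-Barnes lemma makes the second power equal to
    1.\<close>
  have Gm: "integrable lborel (\<lambda>t. G t * of_nat (Suc m) powr (- ?z t))" for m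
    using integrable_Mellin_Barnes[OF c(1,2), of "real (Suc m)" 1]
    by (simp add: G_def mult_ac del: of_nat_Suc)
  have MB: "(\<integral>t. G t * of_nat (Suc m) powr (- ?z t) * of_nat (Suc n) powr (- (s - ?z t)) \<partial>lborel) =
      k * of_nat (Suc m + Suc n) powr (-s)" for m n
    using integral_Mellin_Barnes[OF c(1,2), of "real (Suc m)" "real (Suc n)"]
    by (simp add: G_def k_def mult_ac del: of_nat_Suc flip: of_nat_add)
  \<comment> \<open>\<open>Z\<close> contains the completed sum over n. Thus \<open>I m\<close> will
    be k times the m-th inner sum, and \<open>J\<close> will be k times the double sum.\<close>
  define Z where "Z t = G t * zeta_series (s - ?z t)" for t
  define I where "I m = (\<integral>t. Z t * of_nat (Suc m) powr (- ?z t) \<partial>lborel)" for m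
  define J where "J = (\<integral>t. Z t * zeta_series (?z t) \<partial>lborel)"
  have "(\<lambda>n. k * of_nat (Suc m + Suc n) powr (-s)) sums I m" for m
    using sums_integral_times_zeta_series[OF Gm[of m], of "\<lambda>t. s - ?z t", OF _ _ c(4)]
    unfolding MB by (simp add: I_def Z_def mult_ac)
  then have inner: "(\<lambda>n. of_nat (Suc m + Suc n) powr (-s)) sums (I m / k)" for m
    using sums_divide[of "\<lambda>n. k * of_nat (Suc m + Suc n) powr (-s)" "I m" k] k
    by (simp del: of_nat_Suc of_nat_add)
  \<comment> \<open>At index 0 the power (Suc 0) powr (-z) is 1, so \<open>Gm\<close> gives
    integrability of \<open>G\<close> itself.\<close>
  have Z: "integrable lborel Z"
    using integrable_times_zeta_series[OF Gm[of 0], of "\<lambda>t. s - ?z t", OF _ _ c(4)]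
    by (simp add: Z_def[abs_def])
  have "I sums J"
    using sums_integral_times_zeta_series[OF Z, of ?z, OF _ _ c(3)]
    by (simp add: I_def[abs_def] J_def)
  then have outer: "(\<lambda>m. \<Sum>n. of_nat (Suc m + Suc n) powr (-s)) sums (J / k)"
    unfolding sums_unique[OF inner, symmetric] by (rule sums_divide)
  \<comment> \<open>On the line the two arguments have real parts c > 1 and Re s - c > 1, so both
    zeta values are given by their Dirichlet series.\<close>
  have integrand: "riemann_zeta (?z t) * riemann_zeta (s - ?z t) * Gamma (?z t) * Gamma (s - ?z t) =
      Z t * zeta_series (?z t)" for t
    using c by (simp add: riemann_zeta_def Z_def G_def mult_ac)
  have "integrable lborel (\<lambda>t. Z t * zeta_series (?z t))"
    by (rule integrable_times_zeta_series[OF Z _ _ c(3)]) auto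
  then have "vertical_line_integrable c
      (\<lambda>z. riemann_zeta z * riemann_zeta (s - z) * Gamma z * Gamma (s - z))"
    unfolding vertical_line_integrable_def integrand by simp
  moreover have "vertical_line_integral c
      (\<lambda>z. riemann_zeta z * riemann_zeta (s - z) * Gamma z * Gamma (s - z)) = J * \<i>"
    unfolding vertical_line_integral_def integrand J_def by simp
  \<comment> \<open>The factor i from dz = i dt cancels the one in 1 / (2 pi i), and Gamma(s)
    cancels against \<open>k\<close>.\<close>
  moreover have "Gamma s * (J / k) = 1 / (2 * of_real pi * \<i>) * (J * \<i>)"
    using k by (simp add: k_def)
  ultimately show ?thesis
    using inner outer by (auto simp: sums_iff simp del: of_nat_Suc of_nat_add)
qed

end
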